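(* Let $B\in\mathbb{R}^{n\times n}$ be the cubic B-spline collocation matrix associated with parameters $t_1<t_2<\cdots<t_n$, let $Q=I+S$ be the preconditioner, where $S$ carries the negatives of the super-diagonal entries of $B$ (both as defined in the context), and let $D_{QB}$ be the diagonal part of $QB$. Then the preconditioned Jacobi--PIA $$\boldsymbol{p}^{(k+1)}=\boldsymbol{p}^{(k)}+D_{QB}^{-1}Q\left(\boldsymbol{p}-B\boldsymbol{p}^{(k)}\right),\qquad k=0,1,2,\ldots,$$ is convergent, i.e. its iteration matrix satisfies $\rho\left(I-D_{QB}^{-1}QB\right)<1$.
   Context: Data: points $\boldsymbol{p}_1,\ldots,\boldsymbol{p}_n$ in $\mathbb{R}^2$ or $\mathbb{R}^3$ with parameters $t_1<t_2<\cdots<t_n$. Extend the parameters to the knot vector $\{t_i\}_{i=-2}^{n+3}$ with $t_{-2}=t_{-1}=t_0=t_1<t_2<\cdots<t_n=t_{n+1}=t_{n+2}=t_{n+3}$. Let $\{N_i^3(t)\}_{i=-2}^{n-1}$ be the (normalized) cubic B-spline basis on this knot vector, where $N_i^3$ has support $[t_i,t_{i+4}]$. Collocation matrix: $B=(b_{ij})\in\mathbb{R}^{n\times n}$ is the tridiagonal matrix with $b_{11}=1$, $b_{12}=0$, $b_{n,n-1}=0$, $b_{nn}=1$, and for $2\le i\le n-1$: $b_{i,i-1}=N_{i-3}^3(t_i)$, $b_{ii}=N_{i-2}^3(t_i)$, $b_{i,i+1}=N_{i-1}^3(t_i)$; all other entries are $0$. Preconditioner: $Q=I+S$, where $S$ has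 entries $S_{i,i+1}=-b_{i,i+1}$ for $1\le i\le n-1$ (so $S_{12}=0$) and all other entries $0$. $D_{QB}$ denotes the diagonal matrix with the same diagonal as $QB$ (its diagonal entries are positive, so it is invertible). Write $\boldsymbol{p}=[\boldsymbol{p}_1,\ldots,\boldsymbol{p}_n]^T$ (one data point per row), and $\boldsymbol{p}^{(k)}=[\boldsymbol{p}_1^{(k)},\ldots,\boldsymbol{p}_n^{(k)}]^T$ for the control points at step $k$. $\rho(\cdot)$ is the spectral radius. A stationary iteration $\boldsymbol{x}^{(k+1)}=G\boldsymbol{x}^{(k)}+\boldsymbol{c}$ is called convergent if its iteration matrix $G$ satisfies $\rho(G)<1$ (equivalently, the iterates converge for every initial guess and every $\boldsymbol{c}$). *)

theory Defs
  imports
    Complex_Main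
    Jordan_Normal_Form.Spectral_Radius
    Jordan_Normal_Form.Gauss_Jordan_Elimination
begin

text \<open>Knots, parameters and B-splines are indexed as in the literature (parameters
  \<open>t\<^sub>1, \<dots>, t\<^sub>n\<close>, knots \<open>t\<^bsub>-2\<^esub>, \<dots>, t\<^bsub>n+3\<^esub>\<close>), whereas matrices are indexed from 0.
  Clamping the index to \<open>{1..n}\<close> yields
  \<open>t\<^bsub>-2\<^esub> = t\<^bsub>-1\<^esub> = t\<^sub>0 = t\<^sub>1\<close> and \<open>t\<^sub>n = t\<^bsub>n+1\<^esub> = t\<^bsub>n+2\<^esub> = t\<^bsub>n+3\<^esub>\<close>.\<close>

definition knot :: "nat \<Rightarrow> (nat \<Rightarrow> real) \<Rightarrow> int \<Rightarrow> real" where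
  "knot n t i = t (nat (max 1 (min (int n) i)))"

text \<open>Cox--de Boor recursion for the normalized B-spline of degree \<open>k\<close> supported on
  \<open>[\<tau>\<^sub>i, \<tau>\<^bsub>i+k+1\<^esub>]\<close>. The usual convention that quotients with vanishing denominator
  (repeated knots) count as 0 is the HOL convention \<open>x / 0 = 0\<close>. The half-open intervals in
  degree 0 make all B-splines vanish at the right end point \<open>t\<^sub>n\<close>; the collocation matrix
  only evaluates them at interior parameters.\<close>

fun bspline :: "(int \<Rightarrow> real) \<Rightarrow> nat \<Rightarrow> int \<Rightarrow> real \<Rightarrow> real" where
  "bspline \<tau> 0 i x = (if \<tau> i \<le> x \<and> x < \<tau> (i + 1) then 1 else 0)"
| "bspline \<tau> (Suc k) i x =
     (x - \<tau> i) / (\<tau> (i + int k + 1) - \<tau> i) * bspline \<tau> k i x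
     + (\<tau> (i + int k + 2) - x) / (\<tau> (i + int k + 2) - \<tau> (i + 1)) * bspline \<tau> k (i + 1) x"

definition colloc_entry :: "nat \<Rightarrow> (nat \<Rightarrow> real) \<Rightarrow> nat \<Rightarrow> nat \<Rightarrow> real" where
  "colloc_entry n t i j =
     (if i = 1 \<or> i = n then (if j = i then 1 else 0)
      else if j + 1 = i then bspline (knot n t) 3 (int i - 3) (t i)
      else if j = i then bspline (knot n t) 3 (int i - 2) (t i)
      else if j = i + 1 then bspline (knot n t) 3 (int i - 1) (t i)
      else 0)"

definition colloc_mat :: "nat \<Rightarrow> (nat \<Rightarrow> real) \<Rightarrow> real mat" where
  "colloc_mat n t = mat n n (\<lambda>(i, j). colloc_entry n t (i + 1) (j + 1))"

definition precond :: "real mat \<Rightarrow> real mat" where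
  "precond B = 1\<^sub>m (dim_row B)
     + mat (dim_row B) (dim_row B) (\<lambda>(i, j). if j = i + 1 then - B $$ (i, j) else 0)"

definition diag_part :: "real mat \<Rightarrow> real mat" where
  "diag_part A = mat_diag (dim_row A) (\<lambda>i. A $$ (i, i))"

text \<open>The matrix inverse; unspecified for singular matrices.\<close>

definition mat_inv :: "real mat \<Rightarrow> real mat" where
  "mat_inv A = the (mat_inverse A)"

text \<open>The spectrum of a real matrix is taken over the complex numbers.\<close>

definition real_spectral_radius :: "real mat \<Rightarrow> real" where
  "real_spectral_radius A = spectral_radius (map_mat complex_of_real A)"

text \<open>One step for the data \<open>p\<close> and the current control points \<open>x\<close>, both given with one point
  per row.\<close>

definition precond_jacobi_pia_step ::
  "nat \<Rightarrow> (nat \<Rightarrow> real) \<Rightarrow> real mat \<Rightarrow> real mat \<Rightarrow> real mat" where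
  "precond_jacobi_pia_step n t p x =
     (let B = colloc_mat n t; Q = precond B
      in x + mat_inv (diag_part (Q * B)) * Q * (p - B * x))"

text \<open>Convergence of a stationary iteration \<open>x \<mapsto> G x + c\<close> on \<open>n \<times> d\<close> matrices, with
  iteration matrix \<open>G\<close> acting on each of the \<open>d\<close> columns. For \<open>d > 0\<close> the
  matrices \<open>G\<close> and \<open>c\<close> are determined by the step function.\<close>

definition stationary_convergent :: "nat \<Rightarrow> nat \<Rightarrow> (real mat \<Rightarrow> real mat) \<Rightarrow> bool" where
  "stationary_convergent n d step \<longleftrightarrow>
     (\<exists>G \<in> carrier_mat n n. \<exists>c \<in> carrier_mat n d.
        (\<forall>x \<in> carrier_mat n d. step x = G * x + c) \<and> real_spectral_radius G < 1)"

end

theory Submission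
  imports Defs
begin

text \<open>
  The collocation matrix need not be diagonally dominant: on strongly non-uniform knots the
  subdiagonal value \<open>N\<^bsub>i-3\<^esub>(t\<^sub>i)\<close> can be arbitrarily close to 1. It is diagonally dominant once
  column \<open>j\<close> is scaled by \<open>x\<^sub>j = t\<^bsub>j+1\<^esub> - t\<^bsub>j-1\<^esub>\<close>, and apart
  from the bounds \<open>0 \<le> b\<^bsub>ij\<^esub>\<close> and \<open>b\<^bsub>ii\<^esub> \<le> 1\<close> this is all that B-splines contribute. At the knot \<open>t\<^sub>i\<close> the middle spline is a sum \<open>l + r\<close> of two positive terms
  (the two terms of the Cox--de Boor recursion), and the scaled outer values are
  \<open>b\<^bsub>i,i-1\<^esub> x\<^bsub>i-1\<^esub> = l (t\<^bsub>i+1\<^esub> - t\<^sub>i)\<close> and \<open>b\<^bsub>i,i+1\<^esub> x\<^bsub>i+1\<^esub> = r (t\<^sub>i - t\<^bsub>i-1\<^esub>)\<close>, both of which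
  compare termwise with \<open>b\<^bsub>ii\<^esub> x\<^sub>i = (l + r) (t\<^bsub>i+1\<^esub> - t\<^bsub>i-1\<^esub>)\<close>
  (\<open>colloc_entry_interior_row\<close>).

  The preconditioner preserves this weighted dominance, with the same weights, for every
  nonnegative matrix whose diagonal is bounded by 1 (\<open>weighted_diag_dominant_precond_mult\<close>). In
  terms of M-matrices: if \<open>M\<close> is \<open>B\<close> with the signs of the off-diagonal entries reversed and \<open>C\<close>
  is the superdiagonal of \<open>B\<close>, then weighted dominance of \<open>B\<close> says \<open>M x > 0\<close>, whence also
  \<open>(I + C) M x = M x + C (M x) > 0\<close>; the off-diagonal entries of \<open>(I + C) M\<close> are nonpositive and
  bound those of \<open>Q B\<close> in absolute value, while the diagonals agree.

  Finally, weighted dominance of \<open>Q B\<close> makes the Jacobi iteration matrix a strict contraction in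
  the maximum norm weighted by \<open>x\<close>, so its spectral radius is below 1
  (\<open>jacobi_spectral_radius_less_1\<close>).
\<close>

section \<open>Weighted diagonal dominance and Jacobi iterations\<close>

definition weighted_diag_dominant :: "nat \<Rightarrow> real mat \<Rightarrow> (nat \<Rightarrow> real) \<Rightarrow> bool" where
  "weighted_diag_dominant n A x \<longleftrightarrow>
     (\<forall>i<n. 0 < x i \<and> (\<Sum>j\<in>{..<n} - {i}. \<bar>A $$ (i, j)\<bar> * x j) < \<bar>A $$ (i, i)\<bar> * x i)"

lemma weighted_diag_dominant_diag_nonzero:
  assumes "weighted_diag_dominant n A x" and "i < n"
  shows "A $$ (i, i) \<noteq> 0"
proof
  assume "A $$ (i, i) = 0"
  then have "(\<Sum>j\<in>{..<n} - {i}. \<bar>A $$ (i, j)\<bar> * x j) < 0"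
    using assms unfolding weighted_diag_dominant_def by force
  moreover have "0 \<le> (\<Sum>j\<in>{..<n} - {i}. \<bar>A $$ (i, j)\<bar> * x j)"
    using assms(1) unfolding weighted_diag_dominant_def
    by (intro sum_nonneg mult_nonneg_nonneg) (auto simp: less_imp_le)
  ultimately show False by simp
qed

text \<open>The row sums bound the operator norm belonging to the vector norm
  \<open>max\<^sub>i \<bar>v\<^sub>i\<bar> / x\<^sub>i\<close>. The proof evaluates the eigenvector equation at an index where
  this maximum is attained.\<close>

lemma spectral_radius_less_1_if_weighted_row_sums_less_1:
  fixes G :: "complex mat" and x :: "nat \<Rightarrow> real"
  assumes G: "G \<in> carrier_mat n n" and n: "n > 0"
    and pos: "\<And>i. i < n \<Longrightarrow> 0 < x i"
    and rows: "\<And>i. i < n \<Longrightarrow> (\<Sum>j<n. norm (G $$ (i, j)) * x j) < x i"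
  shows "spectral_radius G < 1"
proof -
  have "norm e < 1" if "eigenvalue G e" for e
  proof -
    from that obtain v where v: "v \<in> carrier_vec n" "v \<noteq> 0\<^sub>v n" "G *\<^sub>v v = e \<cdot>\<^sub>v v"
      using G unfolding eigenvalue_def eigenvector_def by auto
    define r where "r i = norm (v $ i) / x i" for i
    have "Max (r ` {..<n}) \<in> r ` {..<n}" using n by (intro Max_in) auto
    then obtain i where i: "i < n" and "r i = Max (r ` {..<n})" by auto
    then have r_le: "r j \<le> r i" if "j < n" for j
      using that by simp
    have v_le: "norm (v $ j) \<le> r i * x j" if "j < n" for j
      using r_le[OF that] pos[OF that] by (simp add: r_def[of j] pos_divide_le_eq)
    have "r i > 0"
    proof (rule ccontr)
      assume "\<not> r i > 0"
      then have "norm (v $ j) \<le> 0" if "j < n" for j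
        using v_le[OF that] pos[OF that]
        by (meson mult_nonpos_nonneg less_imp_le not_less order_trans)
      then have "v = 0\<^sub>v n" using v(1) by (intro eq_vecI) auto
      with v(2) show False by simp
    qed
    have vi: "norm (v $ i) = r i * x i" using pos[OF i] by (simp add: r_def)
    have "e * v $ i = (\<Sum>j<n. G $$ (i, j) * v $ j)"
      using arg_cong[OF v(3), of "\<lambda>w. w $ i"] i G v(1)
      by (auto simp: scalar_prod_def atLeast0LessThan)
    then have "norm e * (r i * x i) = norm (\<Sum>j<n. G $$ (i, j) * v $ j)"
      by (metis vi norm_mult)
    also have "\<dots> \<le> (\<Sum>j<n. norm (G $$ (i, j)) * (r i * x j))"
      by (intro order_trans[OF norm_sum] sum_mono)
        (auto simp: norm_mult intro!: mult_left_mono v_le)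
    also have "\<dots> = r i * (\<Sum>j<n. norm (G $$ (i, j)) * x j)"
      by (simp add: sum_distrib_left mult_ac)
    also have "\<dots> < r i * x i"
      using rows[OF i] \<open>r i > 0\<close> by simp
    finally show "norm e < 1"
      using \<open>r i > 0\<close> pos[OF i] by simp
  qed
  then show ?thesis
    using spectral_radius_mem_max(1)[OF G n] by (auto simp: spectrum_def)
qed

lemma mat_inv_mat_diag:
  fixes f :: "nat \<Rightarrow> real"
  assumes "\<And>i. i < n \<Longrightarrow> f i \<noteq> 0"
  shows "mat_inv (mat_diag n f) = mat_diag n (\<lambda>i. 1 / f i)"
proof -
  let ?D = "mat_diag n f" and ?E = "mat_diag n (\<lambda>i. 1 / f i)"
  have D: "?D \<in> carrier_mat n n" and E: "?E \<in> carrier_mat n n" by simp_all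
  have one: "?D * ?E = 1\<^sub>m n" "?E * ?D = 1\<^sub>m n"
    using assms unfolding mat_diag_diag by (auto simp: mat_diag_def intro!: eq_matI)
  then have "?D \<in> Units (ring_mat TYPE(real) n ())"
    using D E by (auto simp: Units_def ring_mat_def simp del: mat_diag_diag)
  then obtain C where C: "mat_inverse ?D = Some C"
    using mat_inverse(1)[OF D, where b = "()"] by (cases "mat_inverse ?D") auto
  with mat_inverse(2)[OF D] have C': "?D * C = 1\<^sub>m n" "C \<in> carrier_mat n n"
    by auto
  have "C = ?E * ?D * C" using one C' by (simp del: mat_diag_diag)
  also have "\<dots> = ?E * (?D * C)" using C' D E by (intro assoc_mult_mat)
  also have "\<dots> = ?E" using C'(1) right_mult_one_mat[OF E] by simp
  finally show ?thesis using C by (simp add: mat_inv_def)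
qed

lemma jacobi_spectral_radius_less_1:
  assumes W: "W \<in> carrier_mat n n" and n: "n > 0"
    and dom: "weighted_diag_dominant n W x"
  shows "real_spectral_radius (1\<^sub>m n - mat_inv (diag_part W) * W) < 1"
proof -
  let ?G = "1\<^sub>m n - mat_inv (diag_part W) * W"
  note nz = weighted_diag_dominant_diag_nonzero[OF dom]
  have pos: "0 < x i" if "i < n" for i
    using dom that by (simp add: weighted_diag_dominant_def)
  have "mat_inv (diag_part W) = mat_diag n (\<lambda>i. 1 / W $$ (i, i))"
    using W nz by (simp add: diag_part_def mat_inv_mat_diag)
  then have "mat_inv (diag_part W) * W = mat n n (\<lambda>(i, j). W $$ (i, j) / W $$ (i, i))"
    using W by (simp add: mat_diag_mult_left)
  then have G: "?G = mat n n (\<lambda>(i, j). if i = j then 0 else - (W $$ (i, j) / W $$ (i, i)))"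
    using nz by (intro eq_matI) auto
  have rows: "(\<Sum>j<n. \<bar>?G $$ (i, j)\<bar> * x j) < x i" if i: "i < n" for i
  proof -
    have "(\<Sum>j<n. \<bar>?G $$ (i, j)\<bar> * x j)
        = (\<Sum>j\<in>{..<n} - {i}. \<bar>W $$ (i, j)\<bar> * x j) / \<bar>W $$ (i, i)\<bar>"
      using i unfolding G
      by (subst sum.remove[of _ i]) (auto simp: sum_divide_distrib intro!: sum.cong)
    also have "\<dots> < x i"
      using dom i nz[OF i] by (simp add: weighted_diag_dominant_def pos_divide_less_eq mult.commute)
    finally show ?thesis .
  qed
  show ?thesis unfolding real_spectral_radius_def
  proof (rule spectral_radius_less_1_if_weighted_row_sums_less_1[OF _ n pos])
    show "map_mat complex_of_real ?G \<in> carrier_mat n n"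
      unfolding G by simp
    fix i assume i: "i < n"
    have "(\<Sum>j<n. norm (map_mat complex_of_real ?G $$ (i, j)) * x j)
        = (\<Sum>j<n. \<bar>?G $$ (i, j)\<bar> * x j)"
      using i unfolding G by (intro sum.cong) auto
    then show "(\<Sum>j<n. norm (map_mat complex_of_real ?G $$ (i, j)) * x j) < x i"
      using rows[OF i] by simp
  qed
qed

section \<open>The effect of the preconditioner\<close>

lemma precond_mult_index:
  assumes B: "B \<in> carrier_mat n n" and "i < n" "j < n"
  shows "(precond B * B) $$ (i, j)
    = B $$ (i, j) - (if i + 1 < n then B $$ (i, i + 1) * B $$ (i + 1, j) else 0)"
proof -
  have "(precond B * B) $$ (i, j)
      = (\<Sum>k<n. (if k = i then B $$ (i, j) else 0)
          - (if k = i + 1 then B $$ (i, i + 1) * B $$ (i + 1, j) else 0))"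
    using assms by (auto simp: precond_def scalar_prod_def atLeast0LessThan intro!: sum.cong)
  then show ?thesis using assms by (simp add: sum_subtractf)
qed

text \<open>Row \<open>i\<close> of the product is row \<open>i\<close> minus \<open>c = b\<^bsub>i,i+1\<^esub>\<close> times row \<open>i + 1\<close>. At the
  position \<open>i + 1\<close> the subtraction cancels, leaving \<open>c (1 - b\<^bsub>i+1,i+1\<^esub>) \<ge> 0\<close>; at the other
  off-diagonal positions the triangle inequality suffices. The dominance of row \<open>i + 1\<close>,
  multiplied by \<open>c\<close>, then shows that the gain \<open>c b\<^bsub>i+1,i+1\<^esub> x\<^bsub>i+1\<^esub>\<close> from the cancellation
  pays for everything that row \<open>i + 1\<close> adds, including the decrease of the diagonal.\<close>

lemma weighted_diag_dominant_precond_mult: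
  assumes B: "B \<in> carrier_mat n n"
    and nonneg: "\<And>i j. i < n \<Longrightarrow> j < n \<Longrightarrow> 0 \<le> B $$ (i, j)"
    and diag_le_1: "\<And>i. i < n \<Longrightarrow> B $$ (i, i) \<le> 1"
    and dom: "weighted_diag_dominant n B x"
  shows "weighted_diag_dominant n (precond B * B) x"
  unfolding weighted_diag_dominant_def
proof (intro allI impI conjI)
  fix i assume i: "i < n"
  have pos: "0 < x j" if "j < n" for j
    using dom that by (simp add: weighted_diag_dominant_def)
  then show "0 < x i" using i .
  have row: "(\<Sum>j\<in>{..<n} - {k}. B $$ (k, j) * x j) < B $$ (k, k) * x k" if k: "k < n" for k
  proof -
    have "(\<Sum>j\<in>{..<n} - {k}. B $$ (k, j) * x j) = (\<Sum>j\<in>{..<n} - {k}. \<bar>B $$ (k, j)\<bar> * x j)"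
      using nonneg k by (intro sum.cong) auto
    then show ?thesis
      using dom abs_of_nonneg[OF nonneg[OF k k]] k by (metis weighted_diag_dominant_def)
  qed
  let ?W = "precond B * B"
  show "(\<Sum>j\<in>{..<n} - {i}. \<bar>?W $$ (i, j)\<bar> * x j) < \<bar>?W $$ (i, i)\<bar> * x i"
  proof (cases "i + 1 < n")
    case False
    then show ?thesis
      using row[OF i] i nonneg[OF i] B by (simp add: precond_mult_index)
  next
    case True
    let ?k = "i + 1" and ?c = "B $$ (i, i + 1)"
    have c: "0 \<le> ?c" using nonneg[OF i True] .
    let ?R = "{..<n} - {i, ?k}"
    have split_i: "{..<n} - {i} = insert ?k ?R" and split_k: "{..<n} - {?k} = insert i ?R"
      using i True by auto
    have row_i: "?c * x ?k + (\<Sum>j\<in>?R. B $$ (i, j) * x j) < B $$ (i, i) * x i"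
      using row[OF i] unfolding split_i by simp
    have row_k: "B $$ (?k, i) * x i + (\<Sum>j\<in>?R. B $$ (?k, j) * x j) \<le> B $$ (?k, ?k) * x ?k"
      using row[OF True] unfolding split_k by simp
    have Wk: "\<bar>?W $$ (i, ?k)\<bar> = ?c - ?c * B $$ (?k, ?k)"
      using True i B c mult_left_mono[OF diag_le_1[OF True] c] by (simp add: precond_mult_index)
    have rest: "(\<Sum>j\<in>?R. \<bar>?W $$ (i, j)\<bar> * x j)
        \<le> (\<Sum>j\<in>?R. B $$ (i, j) * x j) + ?c * (\<Sum>j\<in>?R. B $$ (?k, j) * x j)"
    proof -
      have "\<bar>?W $$ (i, j)\<bar> * x j \<le> B $$ (i, j) * x j + ?c * (B $$ (?k, j) * x j)"
        if "j \<in> ?R" for j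
      proof -
        have j: "j < n" using that by simp
        have "\<bar>?W $$ (i, j)\<bar> \<le> B $$ (i, j) + ?c * B $$ (?k, j)"
          using nonneg[OF i j] nonneg[OF True j] c B i j True
          by (simp add: precond_mult_index abs_le_iff)
        then have "\<bar>?W $$ (i, j)\<bar> * x j \<le> (B $$ (i, j) + ?c * B $$ (?k, j)) * x j"
          using pos[OF j] by (intro mult_right_mono) auto
        then show ?thesis by (simp add: algebra_simps)
      qed
      then have "(\<Sum>j\<in>?R. \<bar>?W $$ (i, j)\<bar> * x j)
          \<le> (\<Sum>j\<in>?R. B $$ (i, j) * x j + ?c * (B $$ (?k, j) * x j))"
        by (rule sum_mono)
      then show ?thesis by (simp add: sum.distrib sum_distrib_left)
    qed
    have "(\<Sum>j\<in>{..<n} - {i}. \<bar>?W $$ (i, j)\<bar> * x j)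
        \<le> (?c - ?c * B $$ (?k, ?k)) * x ?k
          + ((\<Sum>j\<in>?R. B $$ (i, j) * x j) + ?c * (\<Sum>j\<in>?R. B $$ (?k, j) * x j))"
      using rest Wk unfolding split_i by simp
    also have "\<dots> < B $$ (i, i) * x i
        + ?c * ((\<Sum>j\<in>?R. B $$ (?k, j) * x j) - B $$ (?k, ?k) * x ?k)"
      using row_i by (simp add: algebra_simps)
    also have "\<dots> \<le> B $$ (i, i) * x i + ?c * (- (B $$ (?k, i) * x i))"
      using row_k c by (intro add_left_mono mult_left_mono) auto
    also have "\<dots> = ?W $$ (i, i) * x i"
      using True i B by (simp add: precond_mult_index algebra_simps)
    also have "\<dots> \<le> \<bar>?W $$ (i, i)\<bar> * x i"
      using pos[OF i] by (intro mult_right_mono) auto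
    finally show ?thesis .
  qed
qed

section \<open>Cubic B-splines at an interior knot\<close>

text \<open>Only the knots next to \<open>\<tau> i\<close> have to be distinct from it. The outermost knots may coincide
  with their neighbours, as they do in the rows adjacent to the boundary of a clamped knot
  vector.\<close>

lemma cubic_bspline_at_simple_knot:
  fixes \<tau> :: "int \<Rightarrow> real"
  assumes mono: "mono \<tau>" and simple: "\<tau> (i - 1) < \<tau> i" "\<tau> i < \<tau> (i + 1)"
  shows "bspline \<tau> 3 (i - 3) (\<tau> i)
      = (\<tau> (i + 1) - \<tau> i)\<^sup>2 / ((\<tau> (i + 1) - \<tau> (i - 2)) * (\<tau> (i + 1) - \<tau> (i - 1)))" (is ?left)
    and "bspline \<tau> 3 (i - 2) (\<tau> i)
      = (\<tau> i - \<tau> (i - 2)) * (\<tau> (i + 1) - \<tau> i)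
          / ((\<tau> (i + 1) - \<tau> (i - 2)) * (\<tau> (i + 1) - \<tau> (i - 1)))
        + (\<tau> (i + 2) - \<tau> i) * (\<tau> i - \<tau> (i - 1))
          / ((\<tau> (i + 2) - \<tau> (i - 1)) * (\<tau> (i + 1) - \<tau> (i - 1)))" (is ?middle)
    and "bspline \<tau> 3 (i - 1) (\<tau> i)
      = (\<tau> i - \<tau> (i - 1))\<^sup>2 / ((\<tau> (i + 2) - \<tau> (i - 1)) * (\<tau> (i + 1) - \<tau> (i - 1)))" (is ?right)
proof -
  have deg0: "bspline \<tau> 0 j (\<tau> i) = (if j = i then 1 else 0)" for j
  proof (cases "j = i")
    case False
    then have "j + 1 \<le> i \<or> i + 1 \<le> j" by linarith
    then have "\<tau> (j + 1) \<le> \<tau> i \<or> \<tau> (i + 1) \<le> \<tau> j"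
      using mono by (auto dest: monoD)
    with False simple show ?thesis by auto
  qed (use simple in simp)
  have deg1: "bspline \<tau> 1 j (\<tau> i) = (if j = i - 1 then 1 else 0)" for j
    using bspline.simps(2)[of \<tau> 0 j "\<tau> i"] simple
    by (auto simp: deg0 add.commute[of 1 i] simp del: bspline.simps(1))
  have deg2_rec: "bspline \<tau> 2 j (\<tau> i) =
     (\<tau> i - \<tau> j) / (\<tau> (j + 2) - \<tau> j) * bspline \<tau> 1 j (\<tau> i)
     + (\<tau> (j + 3) - \<tau> i) / (\<tau> (j + 3) - \<tau> (j + 1)) * bspline \<tau> 1 (j + 1) (\<tau> i)" for j
    using bspline.simps(2)[of \<tau> 1 j "\<tau> i"]
    by (simp add: numeral_2_eq_2 add.assoc del: bspline.simps)
  have deg2: "bspline \<tau> 2 j (\<tau> i) =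
      (if j = i - 2 then (\<tau> (i + 1) - \<tau> i) / (\<tau> (i + 1) - \<tau> (i - 1))
       else if j = i - 1 then (\<tau> i - \<tau> (i - 1)) / (\<tau> (i + 1) - \<tau> (i - 1)) else 0)" for j
    unfolding deg2_rec deg1 by (auto simp: add.commute[of 1 i])
  have deg3: "bspline \<tau> 3 j (\<tau> i) =
     (\<tau> i - \<tau> j) / (\<tau> (j + 3) - \<tau> j) * bspline \<tau> 2 j (\<tau> i)
     + (\<tau> (j + 4) - \<tau> i) / (\<tau> (j + 4) - \<tau> (j + 1)) * bspline \<tau> 2 (j + 1) (\<tau> i)" for j
    using bspline.simps(2)[of \<tau> 2 j "\<tau> i"]
    by (simp add: numeral_3_eq_3 numeral_2_eq_2 add.assoc del: bspline.simps)
  show ?left ?middle ?right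
    unfolding deg3 deg2
    by (simp_all add: power2_eq_square add.commute[of 1 i] add.commute[of 2 i])
qed

section \<open>The collocation matrix\<close>

lemma knot_parameter: "1 \<le> i \<Longrightarrow> i \<le> n \<Longrightarrow> knot n t (int i) = t i"
  by (simp add: knot_def)

lemma mono_knot:
  assumes "n \<ge> 1" and "strict_mono_on {1..n} t"
  shows "mono (knot n t)"
proof (rule monoI)
  fix i j :: int assume "i \<le> j"
  then show "knot n t i \<le> knot n t j"
    unfolding knot_def using assms
    by (intro strict_mono_on_leD[OF assms(2)]) auto
qed

lemma knot_strict_less:
  assumes "strict_mono_on {1..n} t" and "1 \<le> i" "i < j" "j \<le> int n"
  shows "knot n t i < knot n t j"
  unfolding knot_def using assms
  by (intro strict_mono_onD[OF assms(1)]) auto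

text \<open>The scaling that makes the collocation matrix diagonally dominant. Weights \<open>x\<close> suffice if
  their ratios satisfy
  \<open>h\<^sub>i / (h\<^bsub>i-2\<^esub> + h\<^bsub>i-1\<^esub>) < x\<^sub>i / x\<^bsub>i-1\<^esub> < (h\<^bsub>i-1\<^esub> + h\<^sub>i) / h\<^bsub>i-2\<^esub>\<close> with
  \<open>h\<^sub>j = t\<^bsub>j+1\<^esub> - t\<^sub>j\<close>. The choice \<open>x\<^sub>i = h\<^bsub>i-1\<^esub> + h\<^sub>i\<close> takes the numerator from the upper
  bound and the denominator from the lower one.\<close>

definition knot_gap :: "nat \<Rightarrow> (nat \<Rightarrow> real) \<Rightarrow> nat \<Rightarrow> real" where
  "knot_gap n t i = knot n t (int i + 1) - knot n t (int i - 1)"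

lemma knot_gap_pos:
  assumes n: "n \<ge> 2" and t: "strict_mono_on {1..n} t" and i: "1 \<le> i" "i \<le> n"
  shows "0 < knot_gap n t i"
proof -
  have "mono (knot n t)" using n t by (intro mono_knot) auto
  then have le: "knot n t (int i - 1) \<le> knot n t (int i)" "knot n t (int i) \<le> knot n t (int i + 1)"
    by (simp_all add: monoD)
  show ?thesis
  proof (cases "i = n")
    case True
    then have "knot n t (int i - 1) < knot n t (int i)"
      using n by (intro knot_strict_less[OF t]) auto
    with le show ?thesis by (simp add: knot_gap_def)
  next
    case False
    then have "knot n t (int i) < knot n t (int i + 1)"
      using i by (intro knot_strict_less[OF t]) auto
    with le show ?thesis by (simp add: knot_gap_def)
  qed
qed

text \<open>The third part is the weighted dominance described at the beginning: scaling by the gaps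
  turns the squared factor of each outer spline into a multiple of \<open>l\<close> or \<open>r\<close>. The bound on the
  diagonal holds because \<open>l\<close> and \<open>r\<close> are at most the two barycentric coordinates of \<open>t\<^sub>i\<close>
  in the interval from \<open>t\<^bsub>i-1\<^esub>\<close> to \<open>t\<^bsub>i+1\<^esub>\<close>.\<close>

lemma colloc_entry_interior_row:
  assumes t: "strict_mono_on {1..n} t" and i: "1 < i" "i < n"
  shows "0 \<le> colloc_entry n t i j"
    and "colloc_entry n t i i \<le> 1"
    and "colloc_entry n t i (i - 1) * knot_gap n t (i - 1)
        + colloc_entry n t i (i + 1) * knot_gap n t (i + 1)
      < colloc_entry n t i i * knot_gap n t i"
proof -
  define \<tau> where "\<tau> = knot n t"
  define u v w y z where "u = \<tau> (int i - 2)" and "v = \<tau> (int i - 1)" and "w = \<tau> (int i)"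
    and "y = \<tau> (int i + 1)" and "z = \<tau> (int i + 2)"
  note knots = u_def v_def w_def y_def z_def
  have mono: "mono \<tau>" unfolding \<tau>_def using i t by (intro mono_knot) auto
  have vw: "v < w" and wy: "w < y"
    unfolding knots \<tau>_def using i by (auto intro!: knot_strict_less[OF t])
  have uv: "u \<le> v" and yz: "y \<le> z"
    unfolding knots using mono by (simp_all add: monoD)
  have ti: "t i = \<tau> (int i)" unfolding \<tau>_def using i by (simp add: knot_parameter)
  note splines = cubic_bspline_at_simple_knot[OF mono vw[unfolded knots] wy[unfolded knots],
      folded knots]
  define l where "l = (w - u) * (y - w) / ((y - u) * (y - v))"
  define r where "r = (z - w) * (w - v) / ((z - v) * (y - v))"
  have sub: "colloc_entry n t i (i - 1) = (y - w)\<^sup>2 / ((y - u) * (y - v))"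
    using i splines(1) by (simp add: colloc_entry_def ti flip: \<tau>_def w_def)
  have diag: "colloc_entry n t i i = l + r"
    using i splines(2) by (simp add: colloc_entry_def ti l_def r_def flip: \<tau>_def w_def)
  have super: "colloc_entry n t i (i + 1) = (w - v)\<^sup>2 / ((z - v) * (y - v))"
    using i splines(3) by (simp add: colloc_entry_def ti flip: \<tau>_def w_def)
  have l_pos: "0 < l" and r_pos: "0 < r"
    using uv vw wy yz by (auto simp: l_def r_def)
  have off_nonneg: "0 \<le> colloc_entry n t i (i - 1)" "0 \<le> colloc_entry n t i (i + 1)"
    unfolding sub super using uv vw wy yz by auto
  show "0 \<le> colloc_entry n t i j"
  proof -
    consider "j = i - 1" | "j = i" | "j = i + 1" | "j + 1 \<noteq> i" "j \<noteq> i" "j \<noteq> i + 1"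
      by linarith
    then show ?thesis
    proof cases
      case 4
      then show ?thesis by (simp add: colloc_entry_def)
    qed (use off_nonneg diag l_pos r_pos in auto)
  qed
  show "colloc_entry n t i i \<le> 1"
  proof -
    have "(w - u) / (y - u) * ((y - w) / (y - v)) \<le> 1 * ((y - w) / (y - v))"
      "(z - w) / (z - v) * ((w - v) / (y - v)) \<le> 1 * ((w - v) / (y - v))"
      using uv vw wy yz by (intro mult_right_mono; simp add: divide_le_eq)+
    then have "l \<le> (y - w) / (y - v)" "r \<le> (w - v) / (y - v)"
      by (simp_all add: l_def r_def)
    moreover have "(y - w) / (y - v) + (w - v) / (y - v) = 1"
      using vw wy by (simp flip: add_divide_distrib)
    ultimately show ?thesis unfolding diag by linarith
  qed
  have gaps: "knot_gap n t (i - 1) = w - u" "knot_gap n t i = y - v" "knot_gap n t (i + 1) = z - w"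
    using i by (simp_all add: knot_gap_def knots \<tau>_def of_nat_diff add.commute)
  have "colloc_entry n t i (i - 1) * (w - u) = l * (y - w)"
    "colloc_entry n t i (i + 1) * (z - w) = r * (w - v)"
    unfolding sub super l_def r_def by (simp_all add: power2_eq_square mult_ac)
  moreover have "l * (y - w) < l * (y - v)" "r * (w - v) < r * (y - v)"
    using l_pos r_pos vw wy by simp_all
  ultimately show "colloc_entry n t i (i - 1) * knot_gap n t (i - 1)
        + colloc_entry n t i (i + 1) * knot_gap n t (i + 1)
      < colloc_entry n t i i * knot_gap n t i"
    unfolding gaps diag by (simp add: distrib_right)
qed

lemma colloc_mat_nonneg:
  assumes "strict_mono_on {1..n} t" and "i < n" "j < n"
  shows "0 \<le> colloc_mat n t $$ (i, j)"
proof (cases "i = 0 \<or> i + 1 = n")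
  case True
  with assms show ?thesis by (auto simp: colloc_mat_def colloc_entry_def)
next
  case False
  with assms show ?thesis by (simp add: colloc_mat_def colloc_entry_interior_row(1))
qed

lemma colloc_mat_diag_le_1:
  assumes "strict_mono_on {1..n} t" and "i < n"
  shows "colloc_mat n t $$ (i, i) \<le> 1"
proof (cases "i = 0 \<or> i + 1 = n")
  case True
  with assms show ?thesis by (auto simp: colloc_mat_def colloc_entry_def)
next
  case False
  with assms colloc_entry_interior_row(2)[OF assms(1), of "i + 1"] show ?thesis
    by (simp add: colloc_mat_def)
qed

lemma colloc_mat_weighted_diag_dominant:
  assumes n: "n \<ge> 2" and t: "strict_mono_on {1..n} t"
  shows "weighted_diag_dominant n (colloc_mat n t) (\<lambda>i. knot_gap n t (i + 1))"
  unfolding weighted_diag_dominant_def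
proof (intro allI impI conjI)
  let ?B = "colloc_mat n t" and ?x = "\<lambda>i. knot_gap n t (i + 1)"
  fix i assume i: "i < n"
  show "0 < ?x i"
    using knot_gap_pos[OF n t, of "i + 1"] i by simp
  have B: "?B $$ (i, j) = colloc_entry n t (i + 1) (j + 1)" if "j < n" for j
    using i that by (simp add: colloc_mat_def)
  show "(\<Sum>j\<in>{..<n} - {i}. \<bar>?B $$ (i, j)\<bar> * ?x j) < \<bar>?B $$ (i, i)\<bar> * ?x i"
  proof (cases "i = 0 \<or> i + 1 = n")
    case True
    then have "?B $$ (i, j) = (if j = i then 1 else 0)" if "j < n" for j
      using B[OF that] by (auto simp: colloc_entry_def)
    then have "(\<Sum>j\<in>{..<n} - {i}. \<bar>?B $$ (i, j)\<bar> * ?x j) = 0" "?B $$ (i, i) = 1"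
      using i by auto
    with \<open>0 < ?x i\<close> show ?thesis by simp
  next
    case False
    then have inner: "1 < i + 1" "i + 1 < n" using i by auto
    have "(\<Sum>j\<in>{..<n} - {i}. \<bar>?B $$ (i, j)\<bar> * ?x j) = (\<Sum>j\<in>{i - 1, i + 1}. \<bar>?B $$ (i, j)\<bar> * ?x j)"
    proof (rule sum.mono_neutral_right)
      show "\<forall>j\<in>{..<n} - {i} - {i - 1, i + 1}. \<bar>?B $$ (i, j)\<bar> * ?x j = 0"
        using inner by (auto simp: B colloc_entry_def)
    qed (use inner in auto)
    also have "\<dots> = colloc_entry n t (i + 1) i * knot_gap n t i
        + colloc_entry n t (i + 1) (i + 2) * knot_gap n t (i + 2)"
      using inner colloc_entry_interior_row(1)[OF t inner] by (simp add: B)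
    also have "\<dots> < colloc_entry n t (i + 1) (i + 1) * ?x i"
      using colloc_entry_interior_row(3)[OF t inner] by simp
    finally show ?thesis
      using B[OF i] colloc_entry_interior_row(1)[OF t inner] by simp
  qed
qed

section \<open>Convergence of the preconditioned iteration\<close>

lemma stationary_convergent_precond_jacobi_pia_step:
  assumes p: "p \<in> carrier_mat n d" and B: "B = colloc_mat n t" and Q: "Q = precond B"
    and sr: "real_spectral_radius (1\<^sub>m n - mat_inv (diag_part (Q * B)) * Q * B) < 1"
    and inv: "mat_inv (diag_part (Q * B)) \<in> carrier_mat n n"
  shows "stationary_convergent n d (precond_jacobi_pia_step n t p)"
proof -
  let ?P = "mat_inv (diag_part (Q * B)) * Q"
  have Bc: "B \<in> carrier_mat n n" by (simp add: B colloc_mat_def)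
  then have P: "?P \<in> carrier_mat n n" using inv by (auto simp: Q precond_def)
  have "precond_jacobi_pia_step n t p x = (1\<^sub>m n - ?P * B) * x + ?P * p"
    if x: "x \<in> carrier_mat n d" for x
  proof -
    have "precond_jacobi_pia_step n t p x = x + ?P * (p - B * x)"
      by (simp add: precond_jacobi_pia_step_def Let_def B Q)
    also have "\<dots> = x + (?P * p - ?P * (B * x))"
      using P Bc x p by (subst mult_minus_distrib_mat[where n = n]) auto
    also have "\<dots> = (x - ?P * (B * x)) + ?P * p"
      using P Bc x p by (intro eq_matI) auto
    also have "x - ?P * (B * x) = (1\<^sub>m n - ?P * B) * x"
      using P Bc x by (subst minus_mult_distrib_mat[where n = n]) auto
    finally show ?thesis .
  qed
  moreover have "1\<^sub>m n - ?P * B \<in> carrier_mat n n"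
    using mult_carrier_mat[OF P Bc] by (rule minus_carrier_mat)
  moreover have "?P * p \<in> carrier_mat n d"
    using P p by (rule mult_carrier_mat)
  ultimately show ?thesis
    unfolding stationary_convergent_def using sr by blast
qed

theorem theorem4:
  fixes n d :: nat and t :: "nat \<Rightarrow> real" and p B Q :: "real mat"
  assumes "n \<ge> 1"
    and "strict_mono_on {1..n} t"
    and "d = 2 \<or> d = 3"
    and "p \<in> carrier_mat n d"
    and "B = colloc_mat n t"
    and "Q = precond B"
  shows "stationary_convergent n d (precond_jacobi_pia_step n t p)
    \<and> real_spectral_radius (1\<^sub>m n - mat_inv (diag_part (Q * B)) * Q * B) < 1"
proof -
  have B: "B \<in> carrier_mat n n" by (simp add: assms(5) colloc_mat_def)
  then have Q: "Q \<in> carrier_mat n n" by (auto simp: assms(6) precond_def)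
  \<comment> \<open>For a single parameter all knots coincide and the gap vanishes, so another weight is used.\<close>
  obtain x where "weighted_diag_dominant n B x"
  proof (cases "n = 1")
    case True
    then have "weighted_diag_dominant n B (\<lambda>_. 1)"
      by (simp add: weighted_diag_dominant_def assms(5) colloc_mat_def colloc_entry_def)
    then show ?thesis by (rule that)
  next
    case False
    with assms(1) have "n \<ge> 2" by simp
    from colloc_mat_weighted_diag_dominant[OF this assms(2)] show ?thesis
      unfolding assms(5)[symmetric] by (rule that)
  qed
  then have dom: "weighted_diag_dominant n (Q * B) x"
    unfolding assms(6) using B assms(2,5)
    by (intro weighted_diag_dominant_precond_mult)
      (auto simp: colloc_mat_nonneg colloc_mat_diag_le_1)
  have inv: "mat_inv (diag_part (Q * B)) \<in> carrier_mat n n"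
    using Q B weighted_diag_dominant_diag_nonzero[OF dom]
    by (simp add: diag_part_def mat_inv_mat_diag)
  have "real_spectral_radius (1\<^sub>m n - mat_inv (diag_part (Q * B)) * (Q * B)) < 1"
    using Q B assms(1) dom by (intro jacobi_spectral_radius_less_1) auto
  then have "real_spectral_radius (1\<^sub>m n - mat_inv (diag_part (Q * B)) * Q * B) < 1"
    using inv Q B by simp
  then show ?thesis
    using stationary_convergent_precond_jacobi_pia_step[OF assms(4,5,6)] inv by blast
qed

end
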